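(* Fix $c>1$ and $\rho_u\ge0$, and let $\rho_q^*\ge0$ be defined by $c\sqrt{\rho_q^*}+(c-1)\sqrt{\rho_u}=\sqrt{2c-1}$ if $(c-1)\sqrt{\rho_u}\le\sqrt{2c-1}$ (and $\rho_q^*=0$ otherwise). Consider any list-of-points data structure for $(c,r)$-ANN on the Hamming random instance with $n$ points in dimension $d=\omega(\log n)$ that has expected total space at most $n^{1+\rho_u}$ and success probability at least $2/3$. Then its expected query time is at least $n^{\rho_q^*-o(1)}$. Equivalently, if such a data structure has space $n^{1+\rho_u}$ and query time $n^{\rho_q-o(1)}$, then $c\sqrt{\rho_q}+(c-1)\sqrt{\rho_u}\ge\sqrt{2c-1}$.
   Context: List-of-points data structure: there are fixed (possibly random, but chosen independently of the dataset) sets $A_1,\dots,A_m\subseteq\{-1,1\}^d$, and for each possible query $q\in\{-1,1\}^d$ a (possibly random) set of indices $I(q)\subseteq[m]$. For a dataset $P$ the structure stores the lists $L_i=P\cap A_i$. On query $q$ it scans every list $L_i$ with $i\in I(q)$ and returns a point $p\in L_i$ with $\|p-q\|_1\le cr$ if one exists. Total space is $m+\sum_{i=1}^m|L_i|$; query time is $|I(q)|+\sum_{i\in I(q)}|L_i|$. Hamming random instance: $n$ data points independent and uniform in $\{-1,1\}^d$; the query is a uniformly random data point $p$ with each coordinate flipped independently with probability $\frac1{2c}$; here $r=(1+o(1))\frac{d}{2c}$ and success means returning $p$. *)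

theory Defs
  imports "HOL-Probability.Probability"
begin

text \<open>Points of the Hamming cube: \<open>{-1,1}^d\<close> is encoded as boolean lists of length d
  (True = +1, False = -1).\<close>

type_synonym pt = "bool list"

definition cube :: "nat \<Rightarrow> pt set" where
  "cube d = {xs. length xs = d}"

definition hdist :: "pt \<Rightarrow> pt \<Rightarrow> nat" where
  "hdist p q = card {i. i < length p \<and> i < length q \<and> p ! i \<noteq> q ! i}"

fun noisy :: "real \<Rightarrow> pt \<Rightarrow> pt pmf" where
  "noisy eta [] = return_pmf []"
| "noisy eta (b # bs) =
     bind_pmf (bernoulli_pmf eta)
       (\<lambda>f. map_pmf (\<lambda>rest. (if f then \<not> b else b) # rest) (noisy eta bs))"

text \<open>A (deterministic) list-of-points structure: the sets A_i and the index map I.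
  A randomized structure with m lists is a pmf over such pairs (chosen independently of the data).\<close>
type_synonym lop = "(nat \<Rightarrow> pt set) \<times> (pt \<Rightarrow> nat set)"

definition lop_valid :: "nat \<Rightarrow> nat \<Rightarrow> lop pmf \<Rightarrow> bool" where
  "lop_valid d m D \<longleftrightarrow>
     (\<forall>S \<in> set_pmf D. (\<forall>i. fst S i \<subseteq> cube d) \<and> (\<forall>q. snd S q \<subseteq> {..<m}))"

text \<open>Dataset: n points P 0, ..., P (n-1) (indexed, so duplicates are counted).
  |L_i| = |P \<inter> A_i|.\<close>
definition list_size :: "nat \<Rightarrow> (nat \<Rightarrow> pt) \<Rightarrow> pt set \<Rightarrow> nat" where
  "list_size n P Ai = card {j. j < n \<and> P j \<in> Ai}"

definition space :: "nat \<Rightarrow> nat \<Rightarrow> lop \<Rightarrow> (nat \<Rightarrow> pt) \<Rightarrow> nat" where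
  "space n m S P = m + (\<Sum>i<m. list_size n P (fst S i))"

definition qtime :: "nat \<Rightarrow> lop \<Rightarrow> (nat \<Rightarrow> pt) \<Rightarrow> pt \<Rightarrow> nat" where
  "qtime n S P q = card (snd S q) + (\<Sum>i\<in>snd S q. list_size n P (fst S i))"

text \<open>The structure can return the planted point P j on query q: P j lies in a scanned list
  and is within distance cr of q.\<close>
definition success :: "real \<Rightarrow> lop \<Rightarrow> (nat \<Rightarrow> pt) \<Rightarrow> nat \<Rightarrow> pt \<Rightarrow> bool" where
  "success cr S P j q \<longleftrightarrow> (\<exists>i \<in> snd S q. P j \<in> fst S i \<and> real (hdist (P j) q) \<le> cr)"

definition dataset_pmf :: "nat \<Rightarrow> nat \<Rightarrow> (nat \<Rightarrow> pt) pmf" where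
  "dataset_pmf n d = Pi_pmf {..<n} [] (\<lambda>_. pmf_of_set (cube d))"

definition instance_pmf :: "nat \<Rightarrow> nat \<Rightarrow> real \<Rightarrow> ((nat \<Rightarrow> pt) \<times> nat \<times> pt) pmf" where
  "instance_pmf n d c =
     bind_pmf (dataset_pmf n d) (\<lambda>P.
     bind_pmf (pmf_of_set {..<n}) (\<lambda>j.
     map_pmf (\<lambda>q. (P, j, q)) (noisy (1 / (2 * c)) (P (j)))))"

definition lop_experiment :: "lop pmf \<Rightarrow> nat \<Rightarrow> nat \<Rightarrow> real \<Rightarrow> (lop \<times> (nat \<Rightarrow> pt) \<times> nat \<times> pt) pmf" where
  "lop_experiment D n d c = pair_pmf D (instance_pmf n d c)"

definition exp_space :: "nat \<Rightarrow> nat \<Rightarrow> real \<Rightarrow> nat \<Rightarrow> lop pmf \<Rightarrow> ennreal" where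
  "exp_space n d c m D =
     (\<integral>\<^sup>+ w. ennreal (real (space n m (fst w) (fst (snd w)))) \<partial>measure_pmf (lop_experiment D n d c))"

definition exp_qtime :: "nat \<Rightarrow> nat \<Rightarrow> real \<Rightarrow> lop pmf \<Rightarrow> ennreal" where
  "exp_qtime n d c D =
     (\<integral>\<^sup>+ w. ennreal (real (qtime n (fst w) (fst (snd w)) (snd (snd (snd w)))))
        \<partial>measure_pmf (lop_experiment D n d c))"

definition succ_prob :: "nat \<Rightarrow> nat \<Rightarrow> real \<Rightarrow> real \<Rightarrow> lop pmf \<Rightarrow> real" where
  "succ_prob n d c r D =
     measure_pmf.prob (lop_experiment D n d c)
       {w. success (c * r) (fst w) (fst (snd w)) (fst (snd (snd w))) (snd (snd (snd w)))}"

end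

theory Submission
  imports Defs "HOL-Real_Asymp.Real_Asymp"
begin

text \<open>For a fixed structure let \<open>\<alpha>\<^sub>i\<close> be the density of \<open>A\<^sub>i\<close> and \<open>\<beta>\<^sub>i\<close> that of \<open>B\<^sub>i = {q. i \<in> I q}\<close>.  The success
  probability is at most the sum of the probabilities that the planted point lies in \<open>A\<^sub>i\<close> and the query in
  \<open>B\<^sub>i\<close>; hypercontractivity with exponents \<open>(p - 1) * (q - 1) = (1 - 1 / c)\<^sup>2\<close> bounds each of these by
  \<open>\<alpha>\<^sub>i powr (1 / p) * \<beta>\<^sub>i powr (1 / q)\<close>.  The expected space is the sum of
  \<open>1 + n * \<alpha>\<^sub>i\<close>, and the expected query time is at least half the sum of \<open>\<beta>\<^sub>i * (1 + n * \<alpha>\<^sub>i)\<close>.  Linearising both powers bounds the success probability by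
  a linear combination of space and time, which can be averaged over the random structure.
  Optimising the linearisation point \<open>K\<close> and then the exponents gives the trade-off.\<close>

subsection \<open>Two-point hypercontractivity\<close>

text \<open>Advancing two indices at once cancels the two sign changes, so the recursion factor can
  be written with \<open>real n - a\<close> and \<open>real n + 1 - a\<close>, both nonnegative once
  \<open>a \<le> 2 \<le> n\<close>.\<close>

lemma gbinomial_step2:
  fixes a :: real
  shows "a gchoose (n + 2) = (a gchoose n) * ((real n - a) * (real n + 1 - a) / ((real n + 1) * (real n + 2)))"
proof -
  have step: "a gchoose Suc k = (a gchoose k) * (a - real k) / (real k + 1)" for k
    using gbinomial_absorption[of k "a"] gbinomial_mult_1[of a k]
    by (simp add: field_simps)
  have "a gchoose (n + 2) = (a gchoose n) * (a - real n) / (real n + 1) * (a - real (Suc n)) / (real (Suc n) + 1)"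
    by (simp add: step numeral_2_eq_2)
  also have "\<dots> = (a gchoose n) * ((real n - a) * (real n + 1 - a) / ((real n + 1) * (real n + 2)))"
    by (simp add: field_simps)
  finally show ?thesis .
qed

text \<open>At index 2 the two sides agree exactly, because \<open>s * (r - 1) = p - 1\<close>. Each
  further pair of indices multiplies the coefficients by \<open>w r\<close> and \<open>w p\<close>,
  where \<open>w r \<le> w p\<close> since \<open>p \<le> r\<close>, and the extra factor
  \<open>s \<le> 1\<close> only helps. The constant term is left out; Bernoulli's inequality takes
  care of it later.\<close>

lemma gbinomial_even_compare:
  fixes p r s :: real
  assumes "1 < p" "p \<le> r" "r \<le> 2" and s: "s = (p - 1) / (r - 1)"
  shows "0 \<le> r gchoose (2 * j + 2) \<and>
    p / r * (r gchoose (2 * j + 2)) * s ^ (j + 1) \<le> p gchoose (2 * j + 2)"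
proof (induction j)
  case 0
  have "a gchoose 2 = a * (a - 1) / 2" for a :: real
    using gbinomial_step2[of a 0] by (simp add: algebra_simps add_2_eq_Suc numeral_2_eq_2)
  then have e: "r gchoose (2 * 0 + 2) = r * (r - 1) / 2" "p gchoose (2 * 0 + 2) = p * (p - 1) / 2"
    unfolding mult_0_right add_0 by blast+
  have "s * (r - 1) = p - 1" using assms by simp
  moreover have "p / r * (r * (r - 1) / 2) * s = p * (s * (r - 1)) / 2" using assms(1,2) by simp
  ultimately have "p / r * (r * (r - 1) / 2) * s = p * (p - 1) / 2" by simp
  then show ?case unfolding e using assms by simp
next
  case (Suc j)
  define n where "n = 2 * j + 2"
  define w where "w a = (real n - a) * (real n + 1 - a) / ((real n + 1) * (real n + 2))" for a
  have st: "a gchoose (2 * Suc j + 2) = (a gchoose n) * w a" for a :: real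
    using gbinomial_step2[of a n] by (simp add: n_def w_def)
  have n2: "real n \<ge> 2" by (simp add: n_def)
  have w0: "0 \<le> w r" unfolding w_def using assms n2 by (intro divide_nonneg_pos mult_nonneg_nonneg) auto
  have wle: "w r \<le> w p" unfolding w_def using assms n2
    by (intro divide_right_mono mult_mono) auto
  have s01: "0 \<le> s" "s \<le> 1" using assms by (auto simp: s divide_le_eq_1)
  have IH: "0 \<le> r gchoose n" "p / r * (r gchoose n) * s ^ (j + 1) \<le> p gchoose n"
    using Suc.IH by (auto simp: n_def)
  have "p / r * (r gchoose n) * s ^ (j + 1) * (s * w r) \<le> (p gchoose n) * w p"
  proof (intro mult_mono IH)
    show "s * w r \<le> w p" using s01 w0 wle mult_left_le_one_le[of "w r" s] by linarith
    have "0 \<le> p / r * (r gchoose n) * s ^ (j + 1)" using IH(1) s01 assms by simp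
    then show "0 \<le> p gchoose n" using IH(2) by linarith
  qed (use s01 w0 in auto)
  then show ?case unfolding st using IH(1) w0 by (simp add: mult_ac)
qed

text \<open>The mean of \<open>(1 + \<sigma> * z) powr r\<close> over a uniform sign \<sigma>, that
  is, the even part of the binomial series.\<close>

definition even_powr :: "real \<Rightarrow> real \<Rightarrow> real" where
  "even_powr r z = ((1 + z) powr r + (1 - z) powr r) / 2"

lemma even_powr_nonneg: "0 \<le> even_powr r z"
  by (simp add: even_powr_def)

lemma even_powr_sums:
  assumes "\<bar>z\<bar> < 1"
  shows "(\<lambda>n. if even n then (r gchoose n) * z ^ n else 0) sums even_powr r z"
proof -
  have "(\<lambda>n. ((r gchoose n) * z ^ n + (r gchoose n) * (- z) ^ n) * (1 / 2)) sums
      (((1 + z) powr r + (1 + - z) powr r) * (1 / 2))"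
    using assms by (intro sums_mult2 sums_add gen_binomial_real) auto
  moreover have "((r gchoose n) * z ^ n + (r gchoose n) * (- z) ^ n) * (1 / 2) =
      (if even n then (r gchoose n) * z ^ n else 0)" for n
    by auto
  ultimately show ?thesis by (simp add: even_powr_def)
qed

text \<open>The tangent at 1 lies above a concave power; this is weighted AM-GM for \<open>x\<close>
  and 1.\<close>

lemma powr_le_bernoulli:
  fixes x t :: real
  assumes "0 \<le> x" "0 \<le> t" "t \<le> 1"
  shows "x powr t \<le> 1 + t * (x - 1)"
proof (cases "x = 0")
  case False
  then show ?thesis
    using Youngs_inequality_0[of t "1 - t" x 1] assms by (simp add: algebra_simps)
qed (use assms in auto)

text \<open>Bonami's argument: since \<open>p \<le> r \<le> 2\<close>, all even binomial coefficients are nonnegative and, after Bernoulli's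
  inequality, the two binomial series can be compared term by term.\<close>

lemma even_powr_compare_open:
  assumes "1 < p" "p \<le> r" "r \<le> 2" "\<bar>a\<bar> < 1"
  shows "even_powr r (sqrt ((p - 1) / (r - 1)) * a) powr (p / r) \<le> even_powr p a"
proof -
  define s where "s = (p - 1) / (r - 1)"
  define b where "b = sqrt s * a"
  have s01: "0 \<le> s" "s \<le> 1" using assms by (auto simp: s_def divide_le_eq_1)
  have sq1: "sqrt s \<le> 1" "0 \<le> sqrt s" using s01 by auto
  have b1: "\<bar>b\<bar> < 1" using sq1 assms(4) mult_left_le_one_le[of "\<bar>a\<bar>" "sqrt s"]
    by (auto simp: b_def abs_mult)
  let ?u = "\<lambda>r z n. if even n then (r gchoose n) * z ^ n else (0::real)"
  \<comment> \<open>The tangent-line bound of the left side as a power series. Putting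
    \<open>1 - p / r\<close> into coefficient 0 makes the constant terms of both series equal to
    1.\<close>
  have "(\<lambda>n. p / r * ?u r b n + (if n = 0 then 1 - p / r else 0)) sums
      (p / r * even_powr r b + (1 - p / r))"
    using sums_single[of 0 "\<lambda>_. 1 - p / r"]
    by (intro sums_add sums_mult even_powr_sums b1) auto
  moreover have "p / r * ?u r b n + (if n = 0 then 1 - p / r else 0) \<le> ?u p a n" for n
  proof (cases "even n \<and> n \<noteq> 0")
    case True
    then obtain j where n: "n = 2 * j + 2"
      by (metis add_2_eq_Suc' dvd_def even_Suc mult_Suc_right not0_implies_Suc oddE plus_1_eq_Suc add.commute)
    have "b ^ n = s ^ (j + 1) * a ^ n"
      using s01 by (simp add: b_def n power_mult_distrib power_add power_mult)
    then have "p / r * ?u r b n = (p / r * (r gchoose (2 * j + 2)) * s ^ (j + 1)) * a ^ n"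
      using True by (simp add: n)
    also have "\<dots> \<le> (p gchoose n) * a ^ n"
      unfolding n using gbinomial_even_compare[OF assms(1-3) s_def]
      by (intro mult_right_mono zero_le_even_power) auto
    finally show ?thesis using True by simp
  qed auto
  ultimately have "p / r * even_powr r b + (1 - p / r) \<le> even_powr p a"
    by (rule sums_le[OF _ _ even_powr_sums[OF assms(4)], rotated])
  moreover have "even_powr r b powr (p / r) \<le> 1 + p / r * (even_powr r b - 1)"
    using assms by (intro powr_le_bernoulli) (auto simp: even_powr_def)
  ultimately show ?thesis by (simp add: b_def s_def algebra_simps)
qed

text \<open>The endpoints \<open>\<bar>a\<bar> = 1\<close> occur when one of the two values compared
  is 0. The binomial series is used only inside the unit interval, so the inequality for
  \<open>t * a\<close> is carried to the limit as \<open>t\<close> tends to 1 from below.\<close>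

lemma even_powr_compare:
  assumes "1 < p" "p \<le> r" "r \<le> 2" "\<bar>a\<bar> \<le> 1"
  shows "even_powr r (sqrt ((p - 1) / (r - 1)) * a) powr (p / r) \<le> even_powr p a"
proof (rule tendsto_le[of "at_left (1::real)"])
  let ?s = "sqrt ((p - 1) / (r - 1))"
  have s01: "0 \<le> ?s" "?s \<le> 1" using assms by (auto simp: divide_le_eq_1)
  have nn: "\<bar>?s * a\<bar> \<le> 1" using s01 assms(4) by (auto simp: abs_mult intro: mult_le_one)
  have ev: "\<forall>\<^sub>F t in at_left (1::real). 0 < t \<and> t < 1"
    using eventually_at_left_real[of 0 "1::real"] by simp
  have m: "\<bar>t * x\<bar> \<le> 1" if "0 < t" "t < 1" "\<bar>x\<bar> \<le> 1" for t x :: real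
    using that by (auto simp: abs_mult intro: mult_le_one)
  have lim: "((\<lambda>t. even_powr q (t * x)) \<longlongrightarrow> even_powr q x) (at_left 1)"
    if "\<bar>x\<bar> \<le> 1" "q > 0" for q x
  proof -
    \<comment> \<open>At an endpoint one base tends to 0; continuity of \<open>powr\<close> there
      rests on the positive exponent and on the base being eventually nonnegative.\<close>
    have "((\<lambda>t. even_powr q (t * x)) \<longlongrightarrow> even_powr q (1 * x)) (at_left 1)"
      unfolding even_powr_def using that
      by (intro tendsto_intros disjI2 conjI eventually_mono[OF ev])
        (use m[OF _ _ that(1)] in \<open>auto simp: abs_le_iff\<close>, (smt (verit))+)
    then show ?thesis by simp
  qed
  show "((\<lambda>t. even_powr p (t * a)) \<longlongrightarrow> even_powr p a) (at_left 1)"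
    using assms by (intro lim) auto
  have "((\<lambda>t. even_powr r (t * (?s * a)) powr (p / r)) \<longlongrightarrow> even_powr r (?s * a) powr (p / r)) (at_left 1)"
    using assms nn by (intro tendsto_powr' lim tendsto_const) (auto simp: even_powr_def)
  then show "((\<lambda>t. even_powr r (?s * (t * a)) powr (p / r)) \<longlongrightarrow> even_powr r (?s * a) powr (p / r)) (at_left 1)"
    by (simp add: mult_ac)
  show "\<forall>\<^sub>F t in at_left 1. even_powr r (?s * (t * a)) powr (p / r) \<le> even_powr p (t * a)"
  proof (rule eventually_mono[OF ev])
    fix t :: real assume t: "0 < t \<and> t < 1"
    have "\<bar>t * a\<bar> \<le> t" using t assms(4) by (simp add: abs_mult mult_left_le)
    then show "even_powr r (?s * (t * a)) powr (p / r) \<le> even_powr p (t * a)"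
      using t assms by (intro even_powr_compare_open) auto
  qed
qed auto

section \<open>Normalised two-point norms and Bonami's inequality\<close>

definition two_norm :: "real \<Rightarrow> real \<Rightarrow> real \<Rightarrow> real" where
  "two_norm p x y = ((x powr p + y powr p) / 2) powr (1 / p)"

lemma two_norm_nonneg [simp]: "0 \<le> two_norm p x y"
  by (simp add: two_norm_def)

lemma two_norm_mean_diff:
  assumes "p > 0" "m \<ge> 0" "\<bar>a\<bar> \<le> 1"
  shows "two_norm p (m * (1 + a)) (m * (1 - a)) = m * even_powr p a powr (1 / p)"
proof -
  have "((m * (1 + a)) powr p + (m * (1 - a)) powr p) / 2 = m powr p * even_powr p a"
    using assms by (simp add: powr_mult even_powr_def) (simp add: algebra_simps)
  then have "two_norm p (m * (1 + a)) (m * (1 - a)) = (m powr p * even_powr p a) powr (1 / p)"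
    by (simp only: two_norm_def)
  also have "\<dots> = m * even_powr p a powr (1 / p)"
    using assms by (simp add: powr_mult powr_powr even_powr_nonneg)
  finally show ?thesis .
qed

text \<open>The averaging on the left keeps the mean \<open>m\<close> of the pair and multiplies its
  relative deviation \<open>a\<close> by \<open>s\<close>. After pulling out \<open>m\<close>, the
  claim is the \<open>p\<close>-th root of \<open>even_powr_compare\<close>.\<close>

lemma two_norm_contraction:
  assumes p: "1 < p" "p \<le> r" "r \<le> 2" and xy: "0 \<le> x" "0 \<le> y"
    and s: "s = sqrt ((p - 1) / (r - 1))"
  shows "two_norm r ((1 + s) / 2 * x + (1 - s) / 2 * y) ((1 - s) / 2 * x + (1 + s) / 2 * y)
    \<le> two_norm p x y"
proof (cases "x + y = 0")
  case True
  then have "x = 0" "y = 0" using xy by auto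
  then show ?thesis by (simp add: two_norm_def)
next
  case False
  define m where "m = (x + y) / 2"
  define a where "a = (x - y) / (x + y)"
  have pos: "x + y > 0" using False xy by auto
  have a: "\<bar>a\<bar> \<le> 1" using xy pos by (auto simp: a_def abs_le_iff field_simps)
  have s01: "0 \<le> s" "s \<le> 1" using p by (auto simp: s divide_le_eq_1)
  have sa: "\<bar>s * a\<bar> \<le> 1" using s01 a by (auto simp: abs_mult intro: mult_le_one)
  have ma: "m * a = (x - y) / 2" using False unfolding m_def a_def by (metis mult.commute nonzero_mult_div_cancel_right times_divide_eq_right times_divide_times_eq)
  have x: "x = m * (1 + a)" and y: "y = m * (1 - a)"
    unfolding distrib_left right_diff_distrib ma by (simp_all add: m_def field_simps)
  have e1: "(1 + s) / 2 * x + (1 - s) / 2 * y = m * (1 + s * a)"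
    and e2: "(1 - s) / 2 * x + (1 + s) / 2 * y = m * (1 - s * a)"
    unfolding x y by (simp_all add: field_simps)
  have "even_powr r (s * a) powr (1 / r) = (even_powr r (s * a) powr (p / r)) powr (1 / p)"
    using p by (simp add: powr_powr)
  also have "\<dots> \<le> even_powr p a powr (1 / p)"
    using even_powr_compare[OF p a] p unfolding s by (intro powr_mono2) auto
  finally have "m * even_powr r (s * a) powr (1 / r) \<le> m * even_powr p a powr (1 / p)"
    using pos by (intro mult_left_mono) (auto simp: m_def)
  then have "two_norm r (m * (1 + s * a)) (m * (1 - s * a)) \<le> two_norm p (m * (1 + a)) (m * (1 - a))"
    using p a sa xy two_norm_mean_diff[of r m "s * a"] two_norm_mean_diff[of p m a]
    by (simp add: m_def)
  then show ?thesis unfolding e1 e2 using x y by simp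
qed

text \<open>Young's inequality is applied to each pair after division by the norms. A vanishing norm
  forces both values to be 0 and is treated apart.\<close>

lemma two_point_holder:
  assumes p: "1 < p" "1 < q" "1 / p + 1 / q = 1"
    and nn: "0 \<le> x0" "0 \<le> x1" "0 \<le> y0" "0 \<le> y1"
  shows "(x0 * y0 + x1 * y1) / 2 \<le> two_norm p x0 x1 * two_norm q y0 y1"
proof -
  define A where "A = two_norm p x0 x1"
  define B where "B = two_norm q y0 y1"
  have Ap: "A powr p = (x0 powr p + x1 powr p) / 2" and Bq: "B powr q = (y0 powr q + y1 powr q) / 2"
    using p by (simp_all add: A_def B_def two_norm_def powr_powr)
  show ?thesis
  proof (cases "A = 0 \<or> B = 0")
    case True
    then have "x0 powr p + x1 powr p = 0 \<or> y0 powr q + y1 powr q = 0"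
      using Ap Bq p by auto
    then have "x0 = 0 \<and> x1 = 0 \<or> y0 = 0 \<and> y1 = 0"
      by (simp add: add_nonneg_eq_0_iff)
    then show ?thesis by auto
  next
    case False
    then have AB: "A > 0" "B > 0" using two_norm_nonneg unfolding A_def B_def by (metis less_eq_real_def)+
    have Y: "x * y / (A * B) \<le> (x / A) powr p / p + (y / B) powr q / q" if "0 \<le> x" "0 \<le> y" for x y
      using Youngs_inequality[of p q "x / A" "y / B"] p that AB by simp
    have "(x0 * y0 + x1 * y1) / 2 / (A * B) \<le>
        ((x0 / A) powr p / p + (y0 / B) powr q / q + ((x1 / A) powr p / p + (y1 / B) powr q / q)) / 2"
      using Y[of x0 y0] Y[of x1 y1] nn by (simp add: add_divide_distrib)
    also have "\<dots> = ((x0 powr p + x1 powr p) / 2 / A powr p) / p + ((y0 powr q + y1 powr q) / 2 / B powr q) / q"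
      using AB nn by (simp add: powr_divide add_divide_distrib)
    also have "\<dots> = 1 / p + 1 / q"
      unfolding Ap[symmetric] Bq[symmetric] using AB by simp
    finally have "(x0 * y0 + x1 * y1) / 2 / (A * B) \<le> 1" using p by simp
    then show ?thesis using AB by (simp add: A_def B_def)
  qed
qed

text \<open>The left side is the mean of a product over two uniform bits with correlation
  \<open>s\<close>. Since \<open>2 \<le> q\<close>, the conjugate exponent \<open>r\<close> of
  \<open>q\<close> is at most 2, and the condition on the exponents says that \<open>s\<close> is
  exactly the noise contracting from \<open>p\<close> to \<open>r\<close>. Hoelder's inequality with
  \<open>r\<close> and \<open>q\<close> finishes.\<close>

lemma two_point_hypercontractive_ge2:
  assumes pq: "1 < p" "2 \<le> q" "(p - 1) * (q - 1) = s\<^sup>2" "0 \<le> s" "s \<le> 1"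
    and nn: "0 \<le> x0" "0 \<le> x1" "0 \<le> y0" "0 \<le> y1"
  shows "((1 + s) / 2 * (x0 * y0 + x1 * y1) + (1 - s) / 2 * (x0 * y1 + x1 * y0)) / 2
    \<le> two_norm p x0 x1 * two_norm q y0 y1"
proof -
  define r where "r = q / (q - 1)"
  have q: "q - 1 > 0" using pq by simp
  have r: "1 < r" "r \<le> 2" "1 / r + 1 / q = 1" "r - 1 = 1 / (q - 1)"
    using pq by (auto simp: r_def field_simps)
  have "s\<^sup>2 \<le> 1" using pq by (simp add: power_le_one)
  then have pr: "p \<le> r" using r(4) pq(3) q by (smt (verit) divide_strict_right_mono nonzero_eq_divide_eq)
  have s: "s = sqrt ((p - 1) / (r - 1))" using pq r q by simp
  let ?u = "(1 + s) / 2 * x0 + (1 - s) / 2 * x1" and ?v = "(1 - s) / 2 * x0 + (1 + s) / 2 * x1"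
  have "((1 + s) / 2 * (x0 * y0 + x1 * y1) + (1 - s) / 2 * (x0 * y1 + x1 * y0)) / 2 = (?u * y0 + ?v * y1) / 2"
    by (simp add: field_simps)
  also have "\<dots> \<le> two_norm r ?u ?v * two_norm q y0 y1"
    using r pq nn by (intro two_point_holder) auto
  also have "\<dots> \<le> two_norm p x0 x1 * two_norm q y0 y1"
    using two_norm_contraction[OF pq(1) pr r(2) nn(1,2) s] by (intro mult_right_mono) auto
  finally show ?thesis .
qed

text \<open>When both exponents are at most 2, the noise is factored through \<open>L\<^sup>2\<close>, one factor acting on each function.\<close>

lemma two_point_hypercontractive_le2:
  assumes pq: "1 < p" "p \<le> 2" "1 < q" "q \<le> 2" "(p - 1) * (q - 1) = s\<^sup>2" "0 \<le> s" "s \<le> 1"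
    and nn: "0 \<le> x0" "0 \<le> x1" "0 \<le> y0" "0 \<le> y1"
  shows "((1 + s) / 2 * (x0 * y0 + x1 * y1) + (1 - s) / 2 * (x0 * y1 + x1 * y0)) / 2
    \<le> two_norm p x0 x1 * two_norm q y0 y1"
proof -
  \<comment> \<open>\<open>a\<close> and \<open>b\<close> are the noise parameters that contract
    from \<open>p\<close> to 2 and from \<open>q\<close> to 2; the condition on the exponents makes
    their product \<open>s\<close>.\<close>
  define a where "a = sqrt (p - 1)"
  define b where "b = sqrt (q - 1)"
  have ab: "0 \<le> a" "a \<le> 1" "0 \<le> b" "b \<le> 1" using pq by (auto simp: a_def b_def)
  have s: "s = a * b" using pq by (simp add: a_def b_def flip: real_sqrt_mult)
  let ?u = "(1 + a) / 2 * x0 + (1 - a) / 2 * x1" and ?v = "(1 - a) / 2 * x0 + (1 + a) / 2 * x1"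
  let ?w = "(1 + b) / 2 * y0 + (1 - b) / 2 * y1" and ?z = "(1 - b) / 2 * y0 + (1 + b) / 2 * y1"
  have "((1 + s) / 2 * (x0 * y0 + x1 * y1) + (1 - s) / 2 * (x0 * y1 + x1 * y0)) / 2 = (?u * ?w + ?v * ?z) / 2"
    unfolding s by (simp add: field_simps)
  also have "\<dots> \<le> two_norm 2 ?u ?v * two_norm 2 ?w ?z"
    using ab nn by (intro two_point_holder) auto
  also have "\<dots> \<le> two_norm p x0 x1 * two_norm q y0 y1"
    using pq nn by (intro mult_mono two_norm_contraction) (auto simp: a_def b_def)
  finally show ?thesis .
qed

text \<open>The correlated mean is symmetric in the two functions, so \<open>2 \<le> p\<close> is
  the case \<open>2 \<le> q\<close> with the roles exchanged.\<close>

lemma two_point_hypercontractive: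
  assumes pq: "1 < p" "1 < q" "(p - 1) * (q - 1) = s\<^sup>2" "0 \<le> s" "s \<le> 1"
    and nn: "0 \<le> x0" "0 \<le> x1" "0 \<le> y0" "0 \<le> y1"
  shows "((1 + s) / 2 * (x0 * y0 + x1 * y1) + (1 - s) / 2 * (x0 * y1 + x1 * y0)) / 2
    \<le> two_norm p x0 x1 * two_norm q y0 y1"
proof -
  consider "2 \<le> q" | "2 \<le> p" | "p \<le> 2" "q \<le> 2" by linarith
  then show ?thesis
  proof cases
    case 2
    have "((1 + s) / 2 * (y0 * x0 + y1 * x1) + (1 - s) / 2 * (y0 * x1 + y1 * x0)) / 2
        \<le> two_norm q y0 y1 * two_norm p x0 x1"
      using pq nn 2 by (intro two_point_hypercontractive_ge2) (auto simp: mult.commute)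
    then show ?thesis by (simp add: algebra_simps)
  qed (use assms two_point_hypercontractive_ge2 two_point_hypercontractive_le2 in blast)+
qed

subsection \<open>Tensorization over the cube\<close>

lemma cube_0: "cube 0 = {[]}"
  by (auto simp: cube_def)

lemma cube_Suc: "cube (Suc d) = (#) True ` cube d \<union> (#) False ` cube d"
  by (auto simp: cube_def length_Suc_conv image_iff)

lemma finite_cube [simp]: "finite (cube d)"
  by (induction d) (auto simp: cube_0 cube_Suc)

lemma sum_cube_Suc: "sum f (cube (Suc d)) = (\<Sum>x\<in>cube d. f (True # x)) + (\<Sum>x\<in>cube d. f (False # x))"
  unfolding cube_Suc by (subst sum.union_disjoint) (auto simp: sum.reindex)

lemma card_cube: "card (cube d) = 2 ^ d"
  using card_lists_length_eq[of "UNIV :: bool set" d] by (simp add: cube_def)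

lemma pmf_noisy_Cons:
  assumes "0 \<le> \<eta>" "\<eta> \<le> 1"
  shows "pmf (noisy \<eta> (b # x)) (b' # y) = (if b = b' then 1 - \<eta> else \<eta>) * pmf (noisy \<eta> x) y"
proof -
  have "pmf (map_pmf ((#) e) M) (b' # y) = (if e = b' then pmf M y else 0)" for e and M :: "pt pmf"
  proof (cases "e = b'")
    case True
    then show ?thesis by (simp add: pmf_map_inj')
  qed (auto simp: pmf_eq_0_set_pmf)
  then show ?thesis
    using assms by (simp add: pmf_bind)
qed

section \<open>Norms and the noise form on the cube\<close>

definition cube_norm :: "nat \<Rightarrow> real \<Rightarrow> (pt \<Rightarrow> real) \<Rightarrow> real" where
  "cube_norm d p f = ((\<Sum>x\<in>cube d. f x powr p) / 2 ^ d) powr (1 / p)"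

lemma cube_norm_nonneg [simp]: "0 \<le> cube_norm d p f"
  by (simp add: cube_norm_def)

lemma cube_norm_Suc:
  assumes "p > 0"
  shows "cube_norm (Suc d) p f =
    two_norm p (cube_norm d p (\<lambda>x. f (True # x))) (cube_norm d p (\<lambda>x. f (False # x)))"
  using assms by (simp add: cube_norm_def two_norm_def powr_powr sum_cube_Suc sum_nonneg add_divide_distrib mult.commute)

text \<open>The expectation of \<open>f x * g y\<close> for \<open>x\<close> uniform on the cube and
  \<open>y\<close> its noisy copy; for indicators, the probability of a joint hit.\<close>

definition noise_form :: "real \<Rightarrow> nat \<Rightarrow> (pt \<Rightarrow> real) \<Rightarrow> (pt \<Rightarrow> real) \<Rightarrow> real" where
  "noise_form \<eta> d f g = (\<Sum>x\<in>cube d. \<Sum>y\<in>cube d. pmf (noisy \<eta> x) y * f x * g y) / 2 ^ d"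

lemma noise_form_Suc:
  assumes "0 \<le> \<eta>" "\<eta> \<le> 1"
  shows "noise_form \<eta> (Suc d) f g =
    ((1 - \<eta>) * (noise_form \<eta> d (\<lambda>x. f (True # x)) (\<lambda>y. g (True # y)) +
                noise_form \<eta> d (\<lambda>x. f (False # x)) (\<lambda>y. g (False # y))) +
     \<eta> * (noise_form \<eta> d (\<lambda>x. f (True # x)) (\<lambda>y. g (False # y)) +
          noise_form \<eta> d (\<lambda>x. f (False # x)) (\<lambda>y. g (True # y)))) / 2"
proof -
  have scale: "(\<Sum>x\<in>A. \<Sum>y\<in>A. k * u x y * f' x * g' y) = k * (\<Sum>x\<in>A. \<Sum>y\<in>A. u x y * f' x * g' y)"
    for k and A :: "pt set" and u :: "pt \<Rightarrow> pt \<Rightarrow> real" and f' g' :: "pt \<Rightarrow> real"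
    by (simp add: sum_distrib_left mult.assoc)
  show ?thesis
    unfolding noise_form_def sum_cube_Suc pmf_noisy_Cons[OF assms] sum.distrib scale
    by (simp add: field_simps)
qed

text \<open>Induction on the dimension. Fixing the first bits of both points leaves four
  lower-dimensional forms, each bounded by a product of norms of restrictions; the two-point
  inequality with \<open>s = 1 - 2 * \<eta>\<close> is then applied to those norms.\<close>

lemma noise_form_hypercontractive:
  assumes pq: "1 < p" "1 < q" "(p - 1) * (q - 1) = (1 - 2 * \<eta>)\<^sup>2" "0 \<le> \<eta>" "\<eta> \<le> 1 / 2"
    and nn: "\<And>x. 0 \<le> f x" "\<And>x. 0 \<le> g x"
  shows "noise_form \<eta> d f g \<le> cube_norm d p f * cube_norm d q g"
  using nn
proof (induction d arbitrary: f g)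
  case 0
  then show ?case using pq by (simp add: noise_form_def cube_norm_def cube_0 powr_powr)
next
  case (Suc d)
  let ?F = "\<lambda>b. cube_norm d p (\<lambda>x. f (b # x))" and ?G = "\<lambda>b. cube_norm d q (\<lambda>x. g (b # x))"
  have IH: "noise_form \<eta> d (\<lambda>x. f (b # x)) (\<lambda>y. g (b' # y)) \<le> ?F b * ?G b'" for b b'
    using Suc.prems by (intro Suc.IH) auto
  have "noise_form \<eta> (Suc d) f g \<le>
      ((1 - \<eta>) * (?F True * ?G True + ?F False * ?G False) + \<eta> * (?F True * ?G False + ?F False * ?G True)) / 2"
    using pq by (subst noise_form_Suc) (auto intro!: divide_right_mono add_mono mult_left_mono IH)
  also have "\<dots> \<le> two_norm p (?F True) (?F False) * two_norm q (?G True) (?G False)"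
    using two_point_hypercontractive[OF pq(1-3), of "?F True" "?F False" "?G True" "?G False"] pq
    by (simp add: field_simps)
  also have "\<dots> = cube_norm (Suc d) p f * cube_norm (Suc d) q g"
    using pq by (simp add: cube_norm_Suc)
  finally show ?case .
qed

definition cube_mean :: "nat \<Rightarrow> (pt \<Rightarrow> real) \<Rightarrow> real" where
  "cube_mean d f = (\<Sum>x\<in>cube d. f x) / 2 ^ d"

lemma cube_mean_nonneg: "(\<And>x. 0 \<le> f x) \<Longrightarrow> 0 \<le> cube_mean d f"
  by (simp add: cube_mean_def sum_nonneg)

lemma noise_form_nonneg:
  "(\<And>x. 0 \<le> f x) \<Longrightarrow> (\<And>x. 0 \<le> g x) \<Longrightarrow> 0 \<le> noise_form \<eta> d f g"
  by (simp add: noise_form_def sum_nonneg)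

text \<open>The noise preserves the uniform distribution, so a query on its own is uniform.\<close>

lemma noise_form_const_left:
  assumes "0 \<le> \<eta>" "\<eta> \<le> 1"
  shows "noise_form \<eta> d (\<lambda>_. 1) g = cube_mean d g"
proof (induction d arbitrary: g)
  case 0
  then show ?case by (simp add: noise_form_def cube_mean_def cube_0)
next
  case (Suc d)
  show ?case
    unfolding noise_form_Suc[OF assms] Suc.IH by (simp add: cube_mean_def sum_cube_Suc field_simps)
qed

lemma cube_norm_indicator:
  "cube_norm d p (indicator A) = cube_mean d (indicator A) powr (1 / p)"
proof -
  have "indicator A x powr p = (indicator A x :: real)" for x
    by (simp add: indicator_def)
  then show ?thesis by (simp add: cube_norm_def cube_mean_def)
qed

subsection \<open>The random instance\<close>

lemma set_pmf_noisy: "set_pmf (noisy \<eta> x) \<subseteq> cube (length x)"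
proof (induction x)
  case (Cons b x)
  then show ?case by (fastforce simp: cube_def split: if_splits)
qed (simp add: cube_def)

lemma nn_integral_noisy:
  assumes "x \<in> cube d" "\<And>y. 0 \<le> g y"
  shows "(\<integral>\<^sup>+y. ennreal (g y) \<partial>noisy \<eta> x) = ennreal (\<Sum>y\<in>cube d. pmf (noisy \<eta> x) y * g y)"
proof -
  have "set_pmf (noisy \<eta> x) \<subseteq> cube d" using set_pmf_noisy[of \<eta> x] assms by (simp add: cube_def)
  then have "(\<integral>\<^sup>+y. ennreal (g y) \<partial>noisy \<eta> x) = (\<Sum>y\<in>cube d. ennreal (g y) * pmf (noisy \<eta> x) y)"
    by (intro nn_integral_measure_pmf_support) (auto simp: set_pmf_iff)
  also have "\<dots> = (\<Sum>y\<in>cube d. ennreal (pmf (noisy \<eta> x) y * g y))"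
    using assms by (intro sum.cong) (auto simp: ennreal_mult mult.commute)
  finally show ?thesis using assms by (subst (asm) sum_ennreal) auto
qed

lemma cube_nonempty: "cube d \<noteq> {}"
  using card_cube[of d] by force

lemma nn_integral_uniform_cube:
  assumes "\<And>x. x \<in> cube d \<Longrightarrow> 0 \<le> f x"
  shows "(\<integral>\<^sup>+x. ennreal (f x) \<partial>pmf_of_set (cube d)) = ennreal (cube_mean d f)"
  using assms cube_nonempty[of d]
  by (simp add: nn_integral_pmf_of_set card_cube cube_mean_def sum_nonneg flip: divide_ennreal)
    (simp flip: ennreal_power)

lemma nn_integral_dataset_component:
  assumes "j < n"
  shows "(\<integral>\<^sup>+P. F (P j) \<partial>dataset_pmf n d) = (\<integral>\<^sup>+x. F x \<partial>pmf_of_set (cube d))"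
proof -
  have "pmf_of_set (cube d) = map_pmf (\<lambda>P. P j) (dataset_pmf n d)"
    unfolding dataset_pmf_def using assms by (subst Pi_pmf_component) auto
  then show ?thesis by simp
qed

text \<open>Independence of two data points: the product formula over all coordinates, with the
  constant 1 at every other coordinate.\<close>

lemma nn_integral_dataset_two_components:
  assumes "j < n" "k < n" "j \<noteq> k"
  shows "(\<integral>\<^sup>+P. F (P j) * G (P k) \<partial>dataset_pmf n d) =
    (\<integral>\<^sup>+x. F x \<partial>pmf_of_set (cube d)) * (\<integral>\<^sup>+x. G x \<partial>pmf_of_set (cube d))"
proof -
  let ?h = "\<lambda>i. if i = j then F else if i = k then G else (\<lambda>_. 1)"
  have pick: "(\<Prod>i<n. if i = j then a else if i = k then b else 1) = a * (b :: ennreal)" for a b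
  proof -
    have "(\<Prod>i<n. if i = j then a else if i = k then b else 1) =
        (\<Prod>i\<in>{j, k}. if i = j then a else if i = k then b else 1)"
      using assms by (intro prod.mono_neutral_right) auto
    then show ?thesis using assms by simp
  qed
  have "(\<Prod>i<n. ?h i (P i)) = F (P j) * G (P k)" for P :: "nat \<Rightarrow> pt"
    by (subst pick[symmetric], rule prod.cong) auto
  moreover have "(\<Prod>i<n. \<integral>\<^sup>+x. ?h i x \<partial>pmf_of_set (cube d)) =
      (\<integral>\<^sup>+x. F x \<partial>pmf_of_set (cube d)) * (\<integral>\<^sup>+x. G x \<partial>pmf_of_set (cube d))"
    by (subst pick[symmetric], rule prod.cong) auto
  ultimately show ?thesis
    using nn_integral_prod_Pi_pmf[of "{..<n}" "[]" "\<lambda>_. pmf_of_set (cube d)" ?h]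
    by (simp add: dataset_pmf_def)
qed

lemma nn_integral_instance:
  assumes "0 < n"
  shows "(\<integral>\<^sup>+w. h w \<partial>instance_pmf n d c) =
    (\<Sum>j<n. \<integral>\<^sup>+P. \<integral>\<^sup>+q. h (P, j, q) \<partial>noisy (1 / (2 * c)) (P j) \<partial>dataset_pmf n d) / n"
  using assms
  by (simp add: instance_pmf_def nn_integral_pmf_of_set nn_integral_divide nn_integral_sum lessThan_empty_iff)

text \<open>Averaging over the planted index disappears when every index contributes the same
  value.\<close>

lemma nn_integral_instance_const:
  assumes "0 < n"
    and "\<And>j. j < n \<Longrightarrow> (\<integral>\<^sup>+P. \<integral>\<^sup>+q. h (P, j, q) \<partial>noisy (1 / (2 * c)) (P j) \<partial>dataset_pmf n d) = C"
  shows "(\<integral>\<^sup>+w. h w \<partial>instance_pmf n d c) = C"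
  using assms by (simp add: nn_integral_instance ennreal_of_nat_eq_real_of_nat ennreal_mult_divide_eq
      mult.commute[of _ C])

lemma nn_integral_planted:
  assumes "\<And>x. 0 \<le> f x" "\<And>x. 0 \<le> g x" "j < n"
  shows "(\<integral>\<^sup>+P. \<integral>\<^sup>+q. ennreal (f (P j) * g q) \<partial>noisy \<eta> (P j) \<partial>dataset_pmf n d) =
    ennreal (noise_form \<eta> d f g)"
proof -
  have "(\<integral>\<^sup>+P. \<integral>\<^sup>+q. ennreal (f (P j) * g q) \<partial>noisy \<eta> (P j) \<partial>dataset_pmf n d) =
     (\<integral>\<^sup>+x. \<integral>\<^sup>+q. ennreal (f x * g q) \<partial>noisy \<eta> x \<partial>pmf_of_set (cube d))"
    by (rule nn_integral_dataset_component[OF assms(3)])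
  also have "\<dots> = (\<integral>\<^sup>+x. ennreal (\<Sum>y\<in>cube d. pmf (noisy \<eta> x) y * (f x * g y)) \<partial>pmf_of_set (cube d))"
    using cube_nonempty assms(1,2) by (intro nn_integral_cong_AE AE_pmfI nn_integral_noisy) auto
  also have "\<dots> = ennreal (noise_form \<eta> d f g)"
    using assms by (subst nn_integral_uniform_cube)
      (auto intro!: sum_nonneg simp: noise_form_def cube_mean_def mult.assoc)
  finally show ?thesis .
qed

text \<open>The query depends only on the planted point \<open>P j\<close>, so it is independent of
  \<open>P k\<close>, and its own distribution is uniform.\<close>

lemma nn_integral_unplanted:
  assumes \<eta>: "0 \<le> \<eta>" "\<eta> \<le> 1" and fg: "\<And>x. 0 \<le> f x" "\<And>x. 0 \<le> g x" and j: "j < n" "k < n" "j \<noteq> k"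
  shows "(\<integral>\<^sup>+P. \<integral>\<^sup>+q. ennreal (g q * f (P k)) \<partial>noisy \<eta> (P j) \<partial>dataset_pmf n d) =
    ennreal (cube_mean d g * cube_mean d f)"
proof -
  have "(\<integral>\<^sup>+P. \<integral>\<^sup>+q. ennreal (g q * f (P k)) \<partial>noisy \<eta> (P j) \<partial>dataset_pmf n d) =
    (\<integral>\<^sup>+P. (\<integral>\<^sup>+q. ennreal (g q) \<partial>noisy \<eta> (P j)) * ennreal (f (P k)) \<partial>dataset_pmf n d)"
    using fg by (simp add: ennreal_mult nn_integral_multc)
  also have "\<dots> = (\<integral>\<^sup>+x. \<integral>\<^sup>+q. ennreal (g q) \<partial>noisy \<eta> x \<partial>pmf_of_set (cube d)) *
      (\<integral>\<^sup>+x. ennreal (f x) \<partial>pmf_of_set (cube d))"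
    using j by (rule nn_integral_dataset_two_components)
  \<comment> \<open>The mean over the query alone is read as a planted integral with the constant 1
    in place of \<open>f\<close>.\<close>
  also have "(\<integral>\<^sup>+x. \<integral>\<^sup>+q. ennreal (g q) \<partial>noisy \<eta> x \<partial>pmf_of_set (cube d)) =
      (\<integral>\<^sup>+P. \<integral>\<^sup>+q. ennreal (1 * g q) \<partial>noisy \<eta> (P j) \<partial>dataset_pmf n d)"
    by (subst nn_integral_dataset_component[OF j(1),
          where F = "\<lambda>x. \<integral>\<^sup>+q. ennreal (g q) \<partial>noisy \<eta> x", symmetric]) simp
  also have "\<dots> = ennreal (cube_mean d g)"
    using j fg by (subst nn_integral_planted) (auto simp: noise_form_const_left[OF \<eta>])
  also have "(\<integral>\<^sup>+x. ennreal (f x) \<partial>pmf_of_set (cube d)) = ennreal (cube_mean d f)"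
    using fg(1) by (rule nn_integral_uniform_cube)
  finally show ?thesis using fg by (simp add: ennreal_mult cube_mean_nonneg)
qed

section \<open>Space, query time and success in terms of densities\<close>

lemma list_size_sum: "real (list_size n P A) = (\<Sum>k<n. indicator A (P k))"
proof -
  have "{j. j < n \<and> P j \<in> A} = {..<n} \<inter> {j. P j \<in> A}" by auto
  moreover have "indicator A (P k) = (if k \<in> {j. P j \<in> A} then 1 else 0 :: real)" for k
    by (simp add: indicator_def)
  ultimately show ?thesis by (simp add: list_size_def sum.If_cases)
qed

text \<open>Reading the index map list by list turns a sum over the scanned lists into a sum over
  all lists weighted by indicators.\<close>

definition scanners :: "(pt \<Rightarrow> nat set) \<Rightarrow> nat \<Rightarrow> pt set" where
  "scanners I i = {q. i \<in> I q}"

lemma expected_space: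
  assumes n: "0 < n"
  shows "(\<integral>\<^sup>+w. ennreal (real (space n m S (fst w))) \<partial>instance_pmf n d c) =
    ennreal (\<Sum>i<m. 1 + real n * cube_mean d (indicator (fst S i)))"
proof (rule nn_integral_instance_const[OF n])
  fix j
  have "(\<integral>\<^sup>+P. ennreal (real (space n m S P)) \<partial>dataset_pmf n d) =
      (\<integral>\<^sup>+P. (\<Sum>i<m. 1 + (\<Sum>k<n. ennreal (indicator (fst S i) (P k)))) \<partial>dataset_pmf n d)"
    by (simp add: space_def list_size_sum sum.distrib sum_nonneg ennreal_of_nat_eq_real_of_nat flip: sum_ennreal)
  also have "\<dots> = (\<Sum>i<m. 1 + (\<Sum>k<n. \<integral>\<^sup>+P. ennreal (indicator (fst S i) (P k)) \<partial>dataset_pmf n d))"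
    by (simp add: nn_integral_sum nn_integral_add del: sum_ennreal)
  also have "\<dots> = (\<Sum>i<m. 1 + (\<Sum>k<n. ennreal (cube_mean d (indicator (fst S i)))))"
    by (intro sum.cong refl arg_cong2[where f = "(+)"])
      (subst nn_integral_dataset_component, auto simp: nn_integral_uniform_cube)
  also have "\<dots> = (\<Sum>i<m. ennreal (1 + real n * cube_mean d (indicator (fst S i))))"
    by (simp add: cube_mean_nonneg ennreal_mult ennreal_of_nat_eq_real_of_nat)
  also have "\<dots> = ennreal (\<Sum>i<m. 1 + real n * cube_mean d (indicator (fst S i)))"
    by (intro sum_ennreal) (simp add: cube_mean_nonneg)
  finally show "(\<integral>\<^sup>+P. \<integral>\<^sup>+q. ennreal (real (space n m S (fst (P, j, q)))) \<partial>noisy (1 / (2 * c)) (P j)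
      \<partial>dataset_pmf n d) = ennreal (\<Sum>i<m. 1 + real n * cube_mean d (indicator (fst S i)))"
    by simp
qed

text \<open>Only a lower bound is claimed: the planted point is correlated with the query and is
  dropped from the counts. The other \<open>n - 1\<close> points are independent of the query, which
  gives products of densities.\<close>

lemma expected_qtime:
  assumes n: "0 < n" and c: "1 / 2 \<le> c" and S: "\<And>q. snd S q \<subseteq> {..<m}"
  shows "ennreal (\<Sum>i<m. cube_mean d (indicator (scanners (snd S) i)) *
      (1 + (real n - 1) * cube_mean d (indicator (fst S i)))) \<le>
    (\<integral>\<^sup>+w. ennreal (real (qtime n S (fst w) (snd (snd w)))) \<partial>instance_pmf n d c)"
proof -
  let ?B = "\<lambda>i. indicator (scanners (snd S) i) :: pt \<Rightarrow> real" and ?A = "\<lambda>i. indicator (fst S i) :: pt \<Rightarrow> real"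
  let ?\<eta> = "1 / (2 * c)"
  have \<eta>: "0 \<le> ?\<eta>" "?\<eta> \<le> 1" using c by auto
  \<comment> \<open>The factor 1 gives the first summand the shape of
    \<open>nn_integral_planted\<close> for a constant function.\<close>
  define h where "h w = (\<Sum>i<m. ennreal (1 * ?B i (snd (snd w))) +
      (\<Sum>k\<in>{..<n} - {fst (snd w)}. ennreal (?B i (snd (snd w)) * ?A i (fst w k))))"
    for w :: "(nat \<Rightarrow> pt) \<times> nat \<times> pt"
  have "h w \<le> ennreal (real (qtime n S (fst w) (snd (snd w))))" for w
  proof -
    obtain P j q where w: "w = (P, j, q)" by (cases w)
    have "h w = (\<Sum>i<m. ennreal (?B i q * (1 + (\<Sum>k\<in>{..<n} - {j}. ?A i (P k)))))"
      by (simp add: h_def w sum_nonneg sum_distrib_left distrib_left flip: ennreal_plus)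
    also have "\<dots> = ennreal (\<Sum>i<m. ?B i q * (1 + (\<Sum>k\<in>{..<n} - {j}. ?A i (P k))))"
      by (intro sum_ennreal mult_nonneg_nonneg add_nonneg_nonneg sum_nonneg) auto
    also have "\<dots> \<le> ennreal (\<Sum>i<m. ?B i q * (1 + (\<Sum>k<n. ?A i (P k))))"
      by (intro ennreal_leI sum_mono mult_left_mono add_left_mono sum_mono2) auto
    also have "(\<Sum>i<m. ?B i q * (1 + (\<Sum>k<n. ?A i (P k)))) = (\<Sum>i\<in>snd S q. 1 + (\<Sum>k<n. ?A i (P k)))"
      using S[of q] by (intro sum.mono_neutral_cong_right) (auto simp: scanners_def)
    also have "\<dots> = real (qtime n S P q)"
      by (simp add: qtime_def list_size_sum sum.distrib)
    finally show ?thesis by (simp add: w)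
  qed
  then have "(\<integral>\<^sup>+w. h w \<partial>instance_pmf n d c) \<le>
      (\<integral>\<^sup>+w. ennreal (real (qtime n S (fst w) (snd (snd w)))) \<partial>instance_pmf n d c)"
    by (intro nn_integral_mono)
  moreover have "(\<integral>\<^sup>+w. h w \<partial>instance_pmf n d c) =
      ennreal (\<Sum>i<m. cube_mean d (?B i) * (1 + (real n - 1) * cube_mean d (?A i)))"
  proof (rule nn_integral_instance_const[OF n])
    fix j assume j: "j < n"
    have "(\<integral>\<^sup>+P. \<integral>\<^sup>+q. h (P, j, q) \<partial>noisy ?\<eta> (P j) \<partial>dataset_pmf n d) =
        (\<Sum>i<m. (\<integral>\<^sup>+P. \<integral>\<^sup>+q. ennreal (1 * ?B i q) \<partial>noisy ?\<eta> (P j) \<partial>dataset_pmf n d) +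
          (\<Sum>k\<in>{..<n} - {j}.
             \<integral>\<^sup>+P. \<integral>\<^sup>+q. ennreal (?B i q * ?A i (P k)) \<partial>noisy ?\<eta> (P j) \<partial>dataset_pmf n d))"
      unfolding h_def fst_conv snd_conv by (simp add: nn_integral_sum nn_integral_add del: sum_ennreal sum_mult_indicator sum_indicator_mult)
    also have "\<dots> = (\<Sum>i<m. ennreal (cube_mean d (?B i)) +
          (\<Sum>k\<in>{..<n} - {j}. ennreal (cube_mean d (?B i) * cube_mean d (?A i))))"
    proof (intro sum.cong refl arg_cong2[where f = "(+)"])
      show "(\<integral>\<^sup>+P. \<integral>\<^sup>+q. ennreal (1 * ?B i q) \<partial>noisy ?\<eta> (P j) \<partial>dataset_pmf n d) = ennreal (cube_mean d (?B i))" for i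
        using n j by (subst nn_integral_planted) (auto simp: noise_form_const_left[OF \<eta>])
    qed (rule nn_integral_unplanted[OF \<eta> _ _ j], auto)
    also have "\<dots> = (\<Sum>i<m. ennreal (cube_mean d (?B i) * (1 + (real n - 1) * cube_mean d (?A i))))"
    proof (intro sum.cong refl)
      fix i
      have nn: "0 \<le> cube_mean d (?B i)" "0 \<le> cube_mean d (?A i)" by (simp_all add: cube_mean_nonneg)
      have "(\<Sum>k\<in>{..<n} - {j}. ennreal (cube_mean d (?B i) * cube_mean d (?A i))) =
          ennreal (\<Sum>k\<in>{..<n} - {j}. cube_mean d (?B i) * cube_mean d (?A i))"
        using nn by (intro sum_ennreal mult_nonneg_nonneg)
      also have "\<dots> = ennreal ((real n - 1) * (cube_mean d (?B i) * cube_mean d (?A i)))"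
        using j n by (simp add: of_nat_diff)
      also have "ennreal (cube_mean d (?B i)) + \<dots> =
          ennreal (cube_mean d (?B i) + (real n - 1) * (cube_mean d (?B i) * cube_mean d (?A i)))"
        using nn n by (intro ennreal_plus[symmetric] mult_nonneg_nonneg) auto
      also have "cube_mean d (?B i) + (real n - 1) * (cube_mean d (?B i) * cube_mean d (?A i)) =
          cube_mean d (?B i) * (1 + (real n - 1) * cube_mean d (?A i))"
        by (simp add: algebra_simps)
      finally show "ennreal (cube_mean d (?B i)) +
          (\<Sum>k\<in>{..<n} - {j}. ennreal (cube_mean d (?B i) * cube_mean d (?A i))) =
          ennreal (cube_mean d (?B i) * (1 + (real n - 1) * cube_mean d (?A i)))" .
    qed
    also have "\<dots> = ennreal (\<Sum>i<m. cube_mean d (?B i) * (1 + (real n - 1) * cube_mean d (?A i)))"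
      using n by (intro sum_ennreal mult_nonneg_nonneg add_nonneg_nonneg) (auto simp: cube_mean_nonneg)
    finally show "(\<integral>\<^sup>+P. \<integral>\<^sup>+q. h (P, j, q) \<partial>noisy ?\<eta> (P j) \<partial>dataset_pmf n d) = \<dots>" .
  qed
  ultimately show ?thesis by simp
qed

text \<open>Union bound over the lists: on success some list \<open>i\<close> is scanned and
  contains the planted point, an event whose probability is the noise form of the two
  indicators.\<close>

lemma success_probability:
  assumes n: "0 < n" and S: "\<And>q. snd S q \<subseteq> {..<m}"
  shows "(\<integral>\<^sup>+w. indicator {w. success r S (fst w) (fst (snd w)) (snd (snd w))} w \<partial>instance_pmf n d c) \<le>
    ennreal (\<Sum>i<m. noise_form (1 / (2 * c)) d (indicator (fst S i)) (indicator (scanners (snd S) i)))"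
proof -
  let ?B = "\<lambda>i. indicator (scanners (snd S) i) :: pt \<Rightarrow> real" and ?A = "\<lambda>i. indicator (fst S i) :: pt \<Rightarrow> real"
  let ?\<eta> = "1 / (2 * c)"
  define h where "h w = (\<Sum>i<m. ennreal (?A i (fst w (fst (snd w))) * ?B i (snd (snd w))))"
    for w :: "(nat \<Rightarrow> pt) \<times> nat \<times> pt"
  have "indicator {w. success r S (fst w) (fst (snd w)) (snd (snd w))} w \<le> h w" for w
  proof (cases "success r S (fst w) (fst (snd w)) (snd (snd w))")
    case True
    then obtain i where i: "i \<in> snd S (snd (snd w))" "fst w (fst (snd w)) \<in> fst S i"
      by (auto simp: success_def)
    then have "i < m" using S by blast
    then have "ennreal (?A i (fst w (fst (snd w))) * ?B i (snd (snd w))) \<le> h w"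
      unfolding h_def by (intro sum_nonneg_leq_bound[OF _ _ refl] member_le_sum) auto
    then show ?thesis using i by (simp add: scanners_def indicator_def)
  qed auto
  then have "(\<integral>\<^sup>+w. indicator {w. success r S (fst w) (fst (snd w)) (snd (snd w))} w \<partial>instance_pmf n d c) \<le>
      (\<integral>\<^sup>+w. h w \<partial>instance_pmf n d c)"
    by (intro nn_integral_mono)
  also have "\<dots> = ennreal (\<Sum>i<m. noise_form ?\<eta> d (?A i) (?B i))"
  proof (rule nn_integral_instance_const[OF n])
    fix j assume j: "j < n"
    have "(\<integral>\<^sup>+P. \<integral>\<^sup>+q. h (P, j, q) \<partial>noisy ?\<eta> (P j) \<partial>dataset_pmf n d) =
       (\<Sum>i<m. \<integral>\<^sup>+P. \<integral>\<^sup>+q. ennreal (?A i (P j) * ?B i q) \<partial>noisy ?\<eta> (P j) \<partial>dataset_pmf n d)"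
      unfolding h_def by (simp add: nn_integral_sum del: sum_ennreal sum_mult_indicator sum_indicator_mult)
    also have "\<dots> = (\<Sum>i<m. ennreal (noise_form ?\<eta> d (?A i) (?B i)))"
      using n j by (intro sum.cong refl nn_integral_planted) auto
    also have "\<dots> = ennreal (\<Sum>i<m. noise_form ?\<eta> d (?A i) (?B i))"
      by (intro sum_ennreal noise_form_nonneg) auto
    finally show "(\<integral>\<^sup>+P. \<integral>\<^sup>+q. h (P, j, q) \<partial>noisy ?\<eta> (P j) \<partial>dataset_pmf n d) = \<dots>" .
  qed
  finally show ?thesis .
qed

subsection \<open>The trade-off\<close>

text \<open>Bernoulli's inequality at \<open>\<beta> / K\<close>, weakened to simple coefficients.
  The two summands on the right balance at \<open>\<beta> = K\<close>; the free parameter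
  \<open>K\<close> is fixed in \<open>qtime_lower_bound\<close>.\<close>

lemma powr_le_affine:
  fixes K \<beta> t :: real
  assumes "0 < K" "0 \<le> \<beta>" "0 \<le> t" "t \<le> 1"
  shows "\<beta> powr t \<le> K powr t + K powr (t - 1) * \<beta>"
proof -
  have "(\<beta> / K) powr t \<le> 1 + t * (\<beta> / K - 1)" using assms by (intro powr_le_bernoulli) auto
  also have "\<dots> \<le> 1 + \<beta> / K"
  proof -
    have "t * (\<beta> / K) \<le> \<beta> / K" using assms by (intro mult_left_le_one_le) auto
    then show ?thesis using assms by (simp add: right_diff_distrib)
  qed
  finally have "K powr t * (\<beta> / K) powr t \<le> K powr t * (1 + \<beta> / K)"
    by (intro mult_left_mono) auto
  then show ?thesis using assms by (simp add: powr_divide powr_diff distrib_left)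
qed

text \<open>The power of \<alpha> is bounded by a multiple of \<open>1 + N * \<alpha>\<close>, the
  expected space of one list, and the power of \<beta> by an affine function. Their product splits
  into a space term and a query-time term.\<close>

lemma list_term_bound:
  fixes \<alpha> \<beta> N K :: real
  assumes "0 \<le> \<alpha>" "0 \<le> \<beta>" "2 \<le> N" "0 < K" "1 < p" "1 < q"
  shows "\<alpha> powr (1 / p) * \<beta> powr (1 / q) \<le>
    N powr (- 1 / p) * K powr (1 / q) * (1 + N * \<alpha>) +
    2 * N powr (- 1 / p) * K powr (1 / q - 1) * (\<beta> * (1 + (N - 1) * \<alpha>))"
proof -
  have "(N * \<alpha>) powr (1 / p) \<le> 1 + 1 / p * (N * \<alpha> - 1)"
    using assms by (intro powr_le_bernoulli) auto
  also have "\<dots> \<le> 1 + N * \<alpha>"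
  proof -
    have "1 / p * (N * \<alpha>) \<le> N * \<alpha>" using assms by (intro mult_left_le_one_le) auto
    moreover have "0 < 1 / p" using assms by simp
    ultimately show ?thesis unfolding right_diff_distrib mult_1_right by linarith
  qed
  finally have A: "\<alpha> powr (1 / p) \<le> N powr (- 1 / p) * (1 + N * \<alpha>)"
    using assms by (simp add: powr_mult powr_minus_divide field_simps)
  have B: "\<beta> powr (1 / q) \<le> K powr (1 / q) + K powr (1 / q - 1) * \<beta>"
    using assms by (intro powr_le_affine) auto
  \<comment> \<open>The query-time bound counts only \<open>N - 1\<close> points; a factor 2 pays
    for the missing one.\<close>
  have N: "1 + N * \<alpha> \<le> 2 * (1 + (N - 1) * \<alpha>)"
    using mult_right_mono[of 2 N \<alpha>] assms by (simp add: algebra_simps)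
  have "\<alpha> powr (1 / p) * \<beta> powr (1 / q) \<le>
      N powr (- 1 / p) * (1 + N * \<alpha>) * (K powr (1 / q) + K powr (1 / q - 1) * \<beta>)"
    using assms by (intro mult_mono A B) auto
  also have "\<dots> = N powr (- 1 / p) * K powr (1 / q) * (1 + N * \<alpha>) +
      N powr (- 1 / p) * K powr (1 / q - 1) * \<beta> * (1 + N * \<alpha>)"
    by (simp add: algebra_simps)
  also have "\<dots> \<le> N powr (- 1 / p) * K powr (1 / q) * (1 + N * \<alpha>) +
      N powr (- 1 / p) * K powr (1 / q - 1) * \<beta> * (2 * (1 + (N - 1) * \<alpha>))"
    using assms by (intro add_left_mono mult_left_mono N) auto
  finally show ?thesis by (simp only: mult_ac)
qed

text \<open>For each structure in the support, the bound is linear in its expected space and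
  expected query time, so it survives averaging over \<open>D\<close>. The flip probability
  \<open>1 / (2 * c)\<close> gives correlation \<open>1 - 1 / c\<close>.\<close>

lemma success_tradeoff:
  assumes "2 \<le> n" "1 < c" "0 < K" "lop_valid d m D"
    and pq: "1 < p" "1 < q" "(p - 1) * (q - 1) = (1 - 1 / c)\<^sup>2"
  shows "ennreal (succ_prob n d c r D) \<le>
    ennreal (real n powr (- 1 / p) * K powr (1 / q)) * exp_space n d c m D +
    ennreal (2 * real n powr (- 1 / p) * K powr (1 / q - 1)) * exp_qtime n d c D"
    (is "_ \<le> ennreal ?a * _ + ennreal ?b * _")
proof -
  let ?J = "instance_pmf n d c"
  let ?su = "\<lambda>S w. success (c * r) S (fst w) (fst (snd w)) (snd (snd w))"
  let ?sp = "\<lambda>S w. ennreal (real (space n m S (fst w)))"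
  let ?qt = "\<lambda>S w. ennreal (real (qtime n S (fst w) (snd (snd w))))"
  have pw: "(\<integral>\<^sup>+w. indicator {w. ?su S w} w \<partial>?J) \<le>
      ennreal ?a * (\<integral>\<^sup>+w. ?sp S w \<partial>?J) + ennreal ?b * (\<integral>\<^sup>+w. ?qt S w \<partial>?J)" if "S \<in> set_pmf D" for S
  proof -
    have S: "snd S x \<subseteq> {..<m}" for x using assms(4) that by (auto simp: lop_valid_def)
    let ?\<alpha> = "\<lambda>i. cube_mean d (indicator (fst S i))"
    let ?\<beta> = "\<lambda>i. cube_mean d (indicator (scanners (snd S) i))"
    have nn: "0 \<le> ?\<alpha> i" "0 \<le> ?\<beta> i" for i by (simp_all add: cube_mean_nonneg)
    have "(\<integral>\<^sup>+w. indicator {w. ?su S w} w \<partial>?J) \<le>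
        ennreal (\<Sum>i<m. noise_form (1 / (2 * c)) d (indicator (fst S i)) (indicator (scanners (snd S) i)))"
      using assms S by (intro success_probability) auto
    also have "\<dots> \<le> ennreal (\<Sum>i<m. ?\<alpha> i powr (1 / p) * ?\<beta> i powr (1 / q))"
    proof (intro ennreal_leI sum_mono)
      fix i
      have "noise_form (1 / (2 * c)) d (indicator (fst S i)) (indicator (scanners (snd S) i)) \<le>
          cube_norm d p (indicator (fst S i)) * cube_norm d q (indicator (scanners (snd S) i))"
        using assms by (intro noise_form_hypercontractive) auto
      then show "noise_form (1 / (2 * c)) d (indicator (fst S i)) (indicator (scanners (snd S) i)) \<le>
          ?\<alpha> i powr (1 / p) * ?\<beta> i powr (1 / q)"
        by (simp add: cube_norm_indicator)
    qed
    also have "\<dots> \<le> ennreal (\<Sum>i<m. ?a * (1 + real n * ?\<alpha> i) + ?b * (?\<beta> i * (1 + (real n - 1) * ?\<alpha> i)))"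
      using assms nn by (intro ennreal_leI sum_mono list_term_bound) auto
    also have "\<dots> = ennreal (?a * (\<Sum>i<m. 1 + real n * ?\<alpha> i) +
        ?b * (\<Sum>i<m. ?\<beta> i * (1 + (real n - 1) * ?\<alpha> i)))"
      by (subst sum.distrib) (simp only: sum_distrib_left)
    also have "\<dots> = ennreal ?a * ennreal (\<Sum>i<m. 1 + real n * ?\<alpha> i) +
        ennreal ?b * ennreal (\<Sum>i<m. ?\<beta> i * (1 + (real n - 1) * ?\<alpha> i))"
      using assms nn
      by (subst ennreal_plus) (auto simp: ennreal_mult sum_nonneg intro!: mult_nonneg_nonneg sum_nonneg add_nonneg_nonneg)
    also have "\<dots> \<le> ennreal ?a * (\<integral>\<^sup>+w. ?sp S w \<partial>?J) + ennreal ?b * (\<integral>\<^sup>+w. ?qt S w \<partial>?J)"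
      using assms S by (intro add_mono mult_left_mono expected_qtime) (auto simp: expected_space)
    finally show ?thesis .
  qed
  have "ennreal (succ_prob n d c r D) = (\<integral>\<^sup>+S. \<integral>\<^sup>+w. indicator {w. ?su S w} w \<partial>?J \<partial>D)"
  proof -
    have "ennreal (succ_prob n d c r D) = (\<integral>\<^sup>+w. indicator {w. ?su (fst w) (snd w)} w \<partial>lop_experiment D n d c)"
      by (simp add: succ_prob_def measure_pmf.emeasure_eq_measure)
    also have "\<dots> = (\<integral>\<^sup>+S. \<integral>\<^sup>+w. indicator {w. ?su S w} w \<partial>?J \<partial>D)"
      unfolding lop_experiment_def nn_integral_pair_pmf' by (simp add: indicator_def)
    finally show ?thesis .
  qed
  also have "\<dots> \<le> (\<integral>\<^sup>+S. ennreal ?a * (\<integral>\<^sup>+w. ?sp S w \<partial>?J) + ennreal ?b * (\<integral>\<^sup>+w. ?qt S w \<partial>?J) \<partial>D)"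
    by (intro nn_integral_mono_AE AE_pmfI pw)
  also have "\<dots> = ennreal ?a * exp_space n d c m D + ennreal ?b * exp_qtime n d c D"
    by (simp add: nn_integral_add nn_integral_cmult exp_space_def exp_qtime_def lop_experiment_def
        nn_integral_pair_pmf')
  finally show ?thesis .
qed

lemma qtime_lower_bound:
  assumes "2 \<le> n" "1 < c" "lop_valid d m D"
    and pq: "1 < p" "1 < q" "(p - 1) * (q - 1) = (1 - 1 / c)\<^sup>2"
    and space: "exp_space n d c m D \<le> ennreal (real n powr (1 + \<rho>))"
    and succ: "2 / 3 \<le> succ_prob n d c r D"
  shows "ennreal (3 powr (1 - q) / 6 * real n powr (q / p - (1 + \<rho>) * (q - 1))) \<le> exp_qtime n d c D"
proof (cases "exp_qtime n d c D")
  case (real T)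
  define N where "N = real n"
  have N: "2 \<le> N" using assms by (simp add: N_def)
  define e where "e = 1 / p - 1 - \<rho>"
  \<comment> \<open>Chosen so that the space term contributes exactly 1/3. Of the success
    probability 2/3, at least 1/3 is then left to the query-time term.\<close>
  define K where "K = (N powr e / 3) powr q"
  have K: "0 < K" using N by (simp add: K_def)
  let ?a = "N powr (- 1 / p) * K powr (1 / q)" and ?b = "2 * N powr (- 1 / p) * K powr (1 / q - 1)"
  have "?a * N powr (1 + \<rho>) = (N powr (- 1 / p) * N powr e * N powr (1 + \<rho>)) / 3"
    using pq by (simp add: K_def powr_powr)
  also have "\<dots> = 1 / 3" using N by (simp add: e_def flip: powr_add)
  finally have a: "?a * N powr (1 + \<rho>) = 1 / 3" .
  have "ennreal (2 / 3) \<le> ennreal (succ_prob n d c r D)" using succ by (rule ennreal_leI)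
  also have "\<dots> \<le> ennreal ?a * exp_space n d c m D + ennreal ?b * exp_qtime n d c D"
    unfolding N_def by (rule success_tradeoff) (use assms K in auto)
  also have "\<dots> \<le> ennreal ?a * ennreal (N powr (1 + \<rho>)) + ennreal ?b * ennreal T"
    using space real by (intro add_mono mult_left_mono) (auto simp: N_def)
  also have "\<dots> = ennreal (?a * N powr (1 + \<rho>) + ?b * T)"
    using real by (simp add: ennreal_mult)
  also note a
  finally have "2 / 3 \<le> 1 / 3 + ?b * T"
    using real by (subst (asm) ennreal_le_iff) auto
  then have bT: "1 / 3 \<le> ?b * T" by simp
  have "K powr (1 - 1 / q) = (N powr e / 3) powr (q - 1)"
    using pq by (simp add: K_def powr_powr right_diff_distrib)
  also have "\<dots> = 3 powr (1 - q) * N powr (e * (q - 1))"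
    by (simp add: powr_divide powr_powr powr_diff field_simps)
  finally have K': "K powr (1 - 1 / q) = 3 powr (1 - q) * N powr (e * (q - 1))" .
  have "N powr (q / p - (1 + \<rho>) * (q - 1)) = N powr (1 / p) * N powr (e * (q - 1))"
    by (simp add: e_def algebra_simps diff_divide_distrib flip: powr_add)
  \<comment> \<open>The bracketed factor is the reciprocal of \<open>?b\<close>, so the claimed
    bound is \<open>1 / 3\<close> divided by \<open>?b\<close>.\<close>
  then have "3 powr (1 - q) / 6 * N powr (q / p - (1 + \<rho>) * (q - 1)) =
      1 / 3 * (N powr (1 / p) * K powr (1 - 1 / q) / 2)"
    unfolding K' by simp
  also have "\<dots> \<le> ?b * T * (N powr (1 / p) * K powr (1 - 1 / q) / 2)"
    using bT by (intro mult_right_mono) auto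
  also have "\<dots> = T * (N powr (- 1 / p) * N powr (1 / p)) * (K powr (1 / q - 1) * K powr (1 - 1 / q))"
    by simp
  also have "\<dots> = T" using N K by (simp flip: powr_add)
  finally show ?thesis using real by (simp add: N_def ennreal_leI)
qed simp

text \<open>With \<open>u = q - 1\<close> and \<open>p - 1 = s\<^sup>2 / u\<close>, the function of
  \<open>u\<close> is the exponent of \<open>qtime_lower_bound\<close>. Its supremum over positive
  \<open>u\<close> is the square in the hypothesis. It may be only approached, as \<open>u\<close>
  tends to 0 or to infinity, hence the strict bound on \<open>g\<close>.\<close>

lemma exponent_choice:
  fixes s \<rho> g :: real
  assumes s: "0 < s" "s < 1" and \<rho>: "0 \<le> \<rho>" and g: "g < (max 0 (sqrt (1 - s\<^sup>2) - s * sqrt \<rho>))\<^sup>2"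
  obtains u where "0 < u" "g < u * (1 - s\<^sup>2) / (u + s\<^sup>2) - u * \<rho>"
proof -
  define w z where "w = sqrt (1 - s\<^sup>2)" and "z = sqrt \<rho>"
  have s2: "0 < s\<^sup>2" "s\<^sup>2 < 1" using s by (auto simp: power_less_one_iff)
  have w: "0 < w" "1 - s\<^sup>2 = w\<^sup>2" and z: "0 \<le> z" "\<rho> = z\<^sup>2" using s2 \<rho> by (auto simp: w_def z_def)
  consider "g < 0" | "0 \<le> g" "z = 0" | "0 \<le> g" "0 < z" using z by linarith
  then show ?thesis
  proof cases
    case 1
    \<comment> \<open>A small \<open>u\<close> suffices for negative \<open>g\<close>: the first
      term is nonnegative and the loss \<open>u * \<rho>\<close> stays below
      \<open>- g\<close>.\<close>
    define u where "u = - g / (\<rho> + 1)"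
    have u: "0 < u" using 1 \<rho> by (simp add: u_def field_simps)
    have "u * \<rho> < u * (\<rho> + 1)" using u by simp
    also have "\<dots> = - g" using \<rho> by (simp add: u_def)
    finally have "u * \<rho> < - g" .
    moreover have "0 \<le> u * (1 - s\<^sup>2) / (u + s\<^sup>2)" using u s2 by simp
    ultimately show ?thesis using that[OF u] by linarith
  next
    case 2
    have "0 \<le> w" using w by simp
    then have gw: "g < w\<^sup>2" using g 2 by (simp add: w_def z_def max_def)
    \<comment> \<open>Without the loss term the goal reads
      \<open>s\<^sup>2 * g < u * (w\<^sup>2 - g)\<close>; the summand 1 makes it strict.\<close>
    define u where "u = s\<^sup>2 * g / (w\<^sup>2 - g) + 1"
    have "0 \<le> s\<^sup>2 * g / (w\<^sup>2 - g)" using 2 gw s2 by simp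
    then have u: "0 < u" by (simp add: u_def)
    have "u * (w\<^sup>2 - g) = s\<^sup>2 * g + (w\<^sup>2 - g)" using gw by (simp add: u_def distrib_right)
    then have "g * (u + s\<^sup>2) < u * w\<^sup>2" using gw by (simp add: algebra_simps)
    then have "g < u * w\<^sup>2 / (u + s\<^sup>2)" using u s2 by (simp add: pos_less_divide_eq add_pos_pos)
    then show ?thesis using that[OF u] 2 z w by simp
  next
    case 3
    have g': "g < (max 0 (w - s * z))\<^sup>2" using g by (simp add: w_def z_def)
    have sz: "s * z < w"
    proof (rule ccontr)
      assume "\<not> s * z < w"
      then show False using g' 3 by (simp add: max_def split: if_splits)
    qed
    then have gw: "g < (w - s * z)\<^sup>2" using g' by (simp add: max_def)
    \<comment> \<open>The stationary point of the exponent, positive because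
      \<open>s * z < w\<close>; the supremum is attained here.\<close>
    define u where "u = s * w / z - s\<^sup>2"
    have uz: "u * z = s * (w - s * z)" using 3 by (simp add: u_def algebra_simps power2_eq_square)
    then have u: "0 < u" using sz s 3 by (metis diff_gt_0_iff_gt mult_pos_pos zero_less_mult_pos2)
    have "u + s\<^sup>2 = s * w / z" by (simp add: u_def)
    then have "u * (1 - s\<^sup>2) / (u + s\<^sup>2) = u * z * w / s"
      using w s 3 by (simp add: power2_eq_square)
    also have "\<dots> = w * (w - s * z)" using s unfolding uz by simp
    finally have "u * (1 - s\<^sup>2) / (u + s\<^sup>2) - u * \<rho> = w * (w - s * z) - u * z * z"
      by (simp add: z power2_eq_square)
    also have "\<dots> = (w - s * z)\<^sup>2" unfolding uz by (simp add: power2_eq_square algebra_simps)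
    finally show ?thesis using that[OF u] gw by simp
  qed
qed

text \<open>Dividing the defining relation by \<open>c\<close> solves it for the root of the query
  exponent, since \<open>sqrt (1 - (1 - 1 / c)\<^sup>2) = sqrt (2 * c - 1) / c\<close>. The maximum
  with 0 merges the two cases.\<close>

lemma query_exponent:
  fixes c \<rho>\<^sub>u \<rho>\<^sub>q :: real
  assumes c: "1 < c" and \<rho>: "0 \<le> \<rho>\<^sub>q"
    and eq: "(c - 1) * sqrt \<rho>\<^sub>u \<le> sqrt (2 * c - 1) \<Longrightarrow>
           c * sqrt \<rho>\<^sub>q + (c - 1) * sqrt \<rho>\<^sub>u = sqrt (2 * c - 1)"
    and zero: "\<not> (c - 1) * sqrt \<rho>\<^sub>u \<le> sqrt (2 * c - 1) \<Longrightarrow> \<rho>\<^sub>q = 0"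
  shows "\<rho>\<^sub>q = (max 0 (sqrt (1 - (1 - 1 / c)\<^sup>2) - (1 - 1 / c) * sqrt \<rho>\<^sub>u))\<^sup>2"
proof -
  have "1 - (1 - 1 / c)\<^sup>2 = (2 * c - 1) / c\<^sup>2" using c by (simp add: field_simps power2_eq_square)
  then have "sqrt (1 - (1 - 1 / c)\<^sup>2) = sqrt (2 * c - 1) / c" using c by (simp add: real_sqrt_divide)
  then have e: "sqrt (1 - (1 - 1 / c)\<^sup>2) - (1 - 1 / c) * sqrt \<rho>\<^sub>u = (sqrt (2 * c - 1) - (c - 1) * sqrt \<rho>\<^sub>u) / c"
    using c by (simp add: field_simps)
  show ?thesis
  proof (cases "(c - 1) * sqrt \<rho>\<^sub>u \<le> sqrt (2 * c - 1)")
    case True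
    then have "(sqrt (2 * c - 1) - (c - 1) * sqrt \<rho>\<^sub>u) / c = sqrt \<rho>\<^sub>q"
      using eq c by (simp add: field_simps)
    then show ?thesis unfolding e using \<rho> by simp
  next
    case False
    then have "(sqrt (2 * c - 1) - (c - 1) * sqrt \<rho>\<^sub>u) / c \<le> 0" using c by (simp add: divide_nonpos_pos)
    then show ?thesis unfolding e using zero[OF False] by (simp add: max_def)
  qed
qed

theorem theorem1p6:
  fixes c rho_u rho_q :: real and d :: "nat \<Rightarrow> nat" and r :: "nat \<Rightarrow> real"
  assumes "c > 1" and "rho_u \<ge> 0" and "rho_q \<ge> 0"
    and "(c - 1) * sqrt rho_u \<le> sqrt (2 * c - 1) \<Longrightarrow>
           c * sqrt rho_q + (c - 1) * sqrt rho_u = sqrt (2 * c - 1)"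
    and "\<not> ((c - 1) * sqrt rho_u \<le> sqrt (2 * c - 1)) \<Longrightarrow> rho_q = 0"
    and "filterlim (\<lambda>n. real (d n) / ln (real n)) at_top sequentially"
    and "(\<lambda>n. r n / (real (d n) / (2 * c))) \<longlonglongrightarrow> 1"
  shows "\<forall>\<epsilon>>0. eventually (\<lambda>n. \<forall>(m::nat) (D :: lop pmf).
            lop_valid (d n) m D
            \<and> exp_space n (d n) c m D \<le> ennreal (real n powr (1 + rho_u))
            \<and> succ_prob n (d n) c (r n) D \<ge> 2 / 3
            \<longrightarrow> exp_qtime n (d n) c D \<ge> ennreal (real n powr (rho_q - \<epsilon>))) sequentially"
proof (intro allI impI)
  fix \<epsilon> :: real assume \<epsilon>: "0 < \<epsilon>"
  \<comment> \<open>The correlation between a coordinate of the planted point and the same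
    coordinate of the query.\<close>
  define s where "s = 1 - 1 / c"
  have s: "0 < s" "s < 1" using assms(1) by (auto simp: s_def)
  have "rho_q = (max 0 (sqrt (1 - s\<^sup>2) - s * sqrt rho_u))\<^sup>2"
    unfolding s_def using assms(1,3-5) by (rule query_exponent)
  then have "rho_q - \<epsilon> < (max 0 (sqrt (1 - s\<^sup>2) - s * sqrt rho_u))\<^sup>2" using \<epsilon> by simp
  then obtain u where u: "0 < u" "rho_q - \<epsilon> < u * (1 - s\<^sup>2) / (u + s\<^sup>2) - u * rho_u"
    using exponent_choice[OF s assms(2)] by blast
  \<comment> \<open>Every positive \<open>u\<close> yields exponents with
    \<open>(p - 1) * (q - 1) = s\<^sup>2\<close>; \<open>f\<close> is the exponent they give in the
    query-time bound.\<close>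
  define p q f where "p = 1 + s\<^sup>2 / u" and "q = 1 + u" and "f = q / p - (1 + rho_u) * (q - 1)"
  have pq: "1 < p" "1 < q" "(p - 1) * (q - 1) = (1 - 1 / c)\<^sup>2"
    using u s by (auto simp: p_def q_def s_def)
  have "q / p = u * (1 + u) / (u + s\<^sup>2)"
    using u(1) by (simp add: p_def q_def field_simps)
  also have "\<dots> = u * (1 - s\<^sup>2) / (u + s\<^sup>2) + u"
  proof -
    have "u + s\<^sup>2 \<noteq> 0" using u(1) by (simp add: add_pos_nonneg less_imp_neq[symmetric])
    then show ?thesis by (simp add: field_simps)
  qed
  finally have "rho_q - \<epsilon> < f" using u(2) by (simp add: f_def q_def algebra_simps)
  \<comment> \<open>The exponents depend on \<epsilon> but not on \<open>n\<close>, so the strict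
    slack in \<open>f\<close> eventually absorbs the constant of \<open>qtime_lower_bound\<close>,
    uniformly in \<open>m\<close> and \<open>D\<close>.\<close>
  then have "filterlim (\<lambda>n. real n powr (f - (rho_q - \<epsilon>))) at_top sequentially"
    by (intro filterlim_compose[OF real_powr_at_top] filterlim_real_sequentially) simp
  then have "\<forall>\<^sub>F n in sequentially. 6 * 3 powr (q - 1) \<le> real n powr (f - (rho_q - \<epsilon>))"
    by (simp add: filterlim_at_top)
  then show "eventually (\<lambda>n. \<forall>(m::nat) (D :: lop pmf).
            lop_valid (d n) m D
            \<and> exp_space n (d n) c m D \<le> ennreal (real n powr (1 + rho_u))
            \<and> succ_prob n (d n) c (r n) D \<ge> 2 / 3
            \<longrightarrow> exp_qtime n (d n) c D \<ge> ennreal (real n powr (rho_q - \<epsilon>))) sequentially"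
    using eventually_ge_at_top[of 2]
  proof eventually_elim
    case (elim n)
    have "real n powr (rho_q - \<epsilon>) * (6 * 3 powr (q - 1)) \<le> real n powr f"
      using mult_left_mono[OF elim(1), of "real n powr (rho_q - \<epsilon>)"] elim(2)
      by (simp flip: powr_add)
    then have "real n powr (rho_q - \<epsilon>) \<le> 3 powr (1 - q) / 6 * real n powr f"
      by (simp add: powr_diff field_simps)
    then show ?case
      using elim(2) assms(1) pq unfolding f_def
      by (blast intro: order_trans[OF ennreal_leI qtime_lower_bound])
  qed
qed

end
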